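(* Let $G$ be a $3$-connected simple graph with $n$ vertices. Then the rainbow connection number of $G$ satisfies $rc(G)\leq \frac{3(n+1)}{5}$.
   Context: All graphs are finite, simple and undirected. An edge-coloring of a graph $G$ (not necessarily proper) makes $G$ rainbow connected if any two vertices of $G$ are joined by a path all of whose edges have distinct colors. For a connected graph $G$, the rainbow connection number $rc(G)$ is the smallest number of colors needed in an edge-coloring of $G$ that makes $G$ rainbow connected. A graph is $3$-connected if it has more than $3$ vertices and remains connected after deleting any set of at most $2$ vertices. *)

theory Defs
  imports Complex_Main "Graph_Theory.Graph_Theory"
begin

text \<open>
  Finite simple undirected graphs are the symmetric digraphs of the locale \<^locale>\<open>graph\<close>: an
  undirected edge \<open>uv\<close> is a pair of opposite arcs. Edge colorings are therefore functions on the
  unordered pairs of endpoints, so that the two arcs of an edge have the same color.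
\<close>

definition edge_of :: "('a, 'b) pre_digraph \<Rightarrow> 'b \<Rightarrow> 'a set" where
  "edge_of G e = {tail G e, head G e}"

definition edges :: "('a, 'b) pre_digraph \<Rightarrow> 'a set set" where
  "edges G = edge_of G ` arcs G"

text \<open>The name \<open>connected\<close> alone is ambiguous with topological connectedness.\<close>

definition k_connected :: "nat \<Rightarrow> ('a, 'b) pre_digraph \<Rightarrow> bool" where
  "k_connected k G \<longleftrightarrow> card (verts G) > k \<and>
     (\<forall>S \<subseteq> verts G. card S < k \<longrightarrow> Digraph_Component.connected (G \<restriction> (verts G - S)))"

definition rainbow_path ::
  "('a, 'b) pre_digraph \<Rightarrow> ('a set \<Rightarrow> 'c) \<Rightarrow> 'a \<Rightarrow> 'b awalk \<Rightarrow> 'a \<Rightarrow> bool" where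
  "rainbow_path G c u p v \<longleftrightarrow>
     pre_digraph.apath G u p v \<and> distinct (map (\<lambda>e. c (edge_of G e)) p)"

definition rainbow_connected :: "('a, 'b) pre_digraph \<Rightarrow> ('a set \<Rightarrow> 'c) \<Rightarrow> bool" where
  "rainbow_connected G c \<longleftrightarrow> (\<forall>u \<in> verts G. \<forall>v \<in> verts G. \<exists>p. rainbow_path G c u p v)"

text \<open>
  As the value of \<open>LEAST\<close> is unspecified when no such \<open>k\<close> exists, this is meaningful for connected
  graphs only; for these a suitable \<open>k\<close> exists by \<open>rainbow_coloring_exists\<close> below.
\<close>

definition rc :: "('a, 'b) pre_digraph \<Rightarrow> nat" where
  "rc G = (LEAST k. \<exists>c :: 'a set \<Rightarrow> nat. c ` edges G \<subseteq> {..<k} \<and> rainbow_connected G c)"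

lemma (in graph) apath_distinct_edges:
  assumes "apath u p v"
  shows "distinct (map (edge_of G) p)"
  using assms
proof (induction p arbitrary: u)
  case Nil
  then show ?case by simp
next
  case (Cons e p)
  have w: "apath (head G e) p v" and u: "tail G e \<notin> set (awalk_verts (head G e) p)"
    using Cons.prems by (auto simp: apath_Cons_iff)
  have "edge_of G e \<noteq> edge_of G f" if "f \<in> set p" for f
  proof -
    have "tail G f \<in> set (awalk_verts (head G e) p)" "head G f \<in> set (awalk_verts (head G e) p)"
      using that w by (auto simp: apath_def set_awalk_verts)
    then show ?thesis using u by (auto simp: edge_of_def doubleton_eq_iff)
  qed
  then show ?case using Cons.IH[OF w] by auto
qed

lemma (in graph) rainbow_coloring_exists:
  assumes "Digraph_Component.connected G"
  shows "\<exists>k. \<exists>c :: 'a set \<Rightarrow> nat. c ` edges G \<subseteq> {..<k} \<and> rainbow_connected G c"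
proof -
  have fin: "finite (edges G)" by (simp add: edges_def)
  obtain c :: "'a set \<Rightarrow> nat" where c: "inj_on c (edges G)" "c ` edges G = {..<card (edges G)}"
    using ex_bij_betw_finite_nat[OF fin] by (auto simp: bij_betw_def atLeast0LessThan)
  have "\<exists>p. rainbow_path G c u p v" if uv: "u \<in> verts G" "v \<in> verts G" for u v
  proof -
    have "u \<rightarrow>\<^sup>*\<^bsub>G\<^esub> v"
      using symmetric_connected_imp_strongly_connected[OF sym_arcs assms] uv
      by (simp add: strongly_connected_def)
    then obtain p where p: "apath u p v" by (auto simp: reachable_apath)
    then have "set p \<subseteq> arcs G" by (auto simp: apath_def)
    then have "inj_on c (set (map (edge_of G) p))"
      by (intro inj_on_subset[OF c(1)]) (auto simp: edges_def)
    then have "distinct (map c (map (edge_of G) p))"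
      using apath_distinct_edges[OF p] by (simp only: distinct_map)
    then show ?thesis using p by (auto simp: rainbow_path_def comp_def)
  qed
  then have "rainbow_connected G c" by (auto simp: rainbow_connected_def)
  then show ?thesis using c(2) by blast
qed

end

theory Submission
  imports Defs
begin

text \<open>
  Let \<open>H\<close> be a largest set of at least two vertices that can be made rainbow connected, using only
  edges inside \<open>H\<close>, with \<open>m > 0\<close> colors such that \<open>5 m + 1 \<le> 3 |H|\<close>; a single edge qualifies. An ear
  of \<open>H\<close> with \<open>k\<close> inner vertices can be added at the price of \<open>\<lceil>k / 2\<rceil>\<close> colors, which preserves the
  inequality unless \<open>k \<in> {1, 3}\<close>. Hence all ears of \<open>H\<close> have 1 or 3 inner vertices, and 3-connectivity
  then forces every component outside \<open>H\<close> to be a single vertex or a star with at least three leaves,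
  in which each leaf has two neighbours in \<open>H\<close> and the centre has none. Such a remainder needs at most
  four more colors altogether: two for the edges from the leaves (or single vertices) to \<open>H\<close> and two
  for the edges at the centres, with fewer colors when there are fewer than two single vertices or stars.
\<close>

section \<open>Ears with one or three inner vertices\<close>

text \<open>The combinatorics runs on an adjacency relation; arcs return only when walks become
  paths of \<open>G\<close>. Connectivity after deletion is phrased with \<open>rtranclp\<close> so
  that paths can be extracted by induction.\<close>

locale three_connected =
  fixes V :: "'a set" and adj :: "'a \<Rightarrow> 'a \<Rightarrow> bool"
  assumes fin: "finite V"
    and card_V: "card V > 3"
    and adj_sym: "adj u v \<Longrightarrow> adj v u"
    and adj_irrefl: "\<not> adj u u"
    and adj_V: "adj u v \<Longrightarrow> u \<in> V"
    and reach_avoiding: "\<lbrakk>S \<subseteq> V; card S < 3; u \<in> V - S; v \<in> V - S\<rbrakk> \<Longrightarrow>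
      (\<lambda>x y. adj x y \<and> x \<notin> S \<and> y \<notin> S)\<^sup>*\<^sup>* u v"
begin

lemma adj_V2: "adj u v \<Longrightarrow> v \<in> V"
  using adj_V adj_sym by blast

text \<open>Deleting at most two neighbours, if these were all, would cut \<open>x\<close> off from
  a further vertex, which exists as \<open>card V > 3\<close>.\<close>

lemma card_neighbours:
  assumes "x \<in> V"
  shows "card {y. adj x y} \<ge> 3"
proof (rule ccontr)
  let ?N = "{y. adj x y}"
  assume "\<not> card ?N \<ge> 3"
  then have c: "card ?N < 3" by simp
  have N: "?N \<subseteq> V" using adj_V2 by auto
  have "card (insert x ?N) < card V"
    using c card_V card_insert_le_m1[of 3 ?N x] by simp
  then obtain v where v: "v \<in> V" "v \<notin> insert x ?N"
    using card_mono[of "insert x ?N" V] finite_subset[OF N fin] by fastforce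
  have "(\<lambda>u y. adj u y \<and> u \<notin> ?N \<and> y \<notin> ?N)\<^sup>*\<^sup>* x v"
    using reach_avoiding[OF N c, of x v] v assms adj_irrefl by auto
  then show False using v by (cases rule: converse_rtranclpE) auto
qed

text \<open>On a walk from \<open>a\<close> to \<open>b\<close> avoiding \<open>S\<close>, take the
  piece from the last visit to \<open>A\<close> up to the next visit to \<open>B\<close> and cut its
  loops.\<close>

lemma path_avoiding:
  assumes S: "S \<subseteq> V" "card S < 3" and A: "a \<in> A" "a \<in> V - S"
    and B: "b \<in> B" "b \<in> V - S" and disj: "A \<inter> B = {}"
  obtains a' xs b' where "a' \<in> A - S" "b' \<in> B - S" "set xs \<inter> (S \<union> A \<union> B) = {}" "distinct xs"
    "successively adj (a' # xs @ [b'])"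
proof -
  \<comment> \<open>\<open>P\<close> omits \<open>x \<in> A\<close>, so it describes the partial
    path from any vertex of the walk; reaching \<open>A\<close> ends the construction.\<close>
  define P where "P x xs y \<longleftrightarrow> x \<notin> S \<and> y \<in> B - S \<and> set xs \<inter> (S \<union> A \<union> B) = {} \<and> distinct xs
    \<and> successively adj (x # xs @ [y])" for x xs y
  have "(\<lambda>x y. adj x y \<and> x \<notin> S \<and> y \<notin> S)\<^sup>*\<^sup>* a b"
    using reach_avoiding S A B by blast
  then have "a \<in> B \<or> (\<exists>x\<in>A. \<exists>xs y. P x xs y) \<or> (\<exists>xs y. P a xs y)"
  proof (induction rule: converse_rtranclp_induct)
    case base
    then show ?case using B by simp
  next
    case (step u w)
    show ?case
    proof (cases "w \<in> B")
      case True
      then have "P u [] w" using step.hyps by (auto simp: P_def)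
      then show ?thesis by blast
    next
      case False
      show ?thesis
      proof (cases "\<exists>x\<in>A. \<exists>xs y. P x xs y")
        case ex: False
        then obtain xs y where P: "P w xs y" and wA: "w \<notin> A" using step.IH False by blast
        show ?thesis
        proof (cases "w \<in> set xs")
          case True
          then obtain ys zs where "xs = ys @ w # zs" by (meson split_list)
          then have "P u (w # zs) y" using P step.hyps
            by (auto simp: P_def successively_append_iff successively_Cons)
          then show ?thesis by blast
        next
          case nin: False
          then have "P u (w # xs) y" using P step.hyps False wA
            by (auto simp: P_def successively_Cons)
          then show ?thesis by blast
        qed
      qed blast
    qed
  qed
  then have "\<exists>x\<in>A. \<exists>xs y. P x xs y" using A disj by blast
  then show ?thesis using that by (auto simp: P_def)
qed

definition ear :: "'a set \<Rightarrow> 'a \<Rightarrow> 'a list \<Rightarrow> 'a \<Rightarrow> bool" where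
  "ear H a xs b \<longleftrightarrow> a \<in> H \<and> b \<in> H \<and> a \<noteq> b \<and> xs \<noteq> [] \<and> set xs \<inter> H = {} \<and> distinct xs
    \<and> successively adj (a # xs @ [b])"

lemma ear_rev: "ear H a xs b \<Longrightarrow> ear H b (rev xs) a"
proof -
  assume e: "ear H a xs b"
  have "successively adj (rev (a # xs @ [b]))"
    using e successively_rev[of adj "a # xs @ [b]"] successively_mono[of adj "a # xs @ [b]" "\<lambda>x y. adj y x"] adj_sym
    by (simp add: ear_def)
  then show ?thesis using e by (auto simp: ear_def)
qed

end

text \<open>\<open>ear_length\<close> is what maximality of \<open>H\<close> will provide: an ear of
  any other length could be added at an affordable price in colors.\<close>

locale ear_restricted = three_connected +
  fixes H :: "'a set"
  assumes H_V: "H \<subseteq> V"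
    and card_H: "card H \<ge> 2"
    and ear_length: "ear H a xs b \<Longrightarrow> length xs = 1 \<or> length xs = 3"
begin

lemma ex_other_in_H: obtains h where "h \<in> H" "h \<noteq> a"
proof -
  have "\<not> H \<subseteq> {a}" using card_H card_mono[of "{a}" H] by auto
  then show ?thesis using that by blast
qed

lemma no_ear:
  assumes "ear H a xs b" "length xs \<noteq> 1" "length xs \<noteq> 3"
  shows False
  using ear_length[OF assms(1)] assms(2,3) by simp

text \<open>After deletion of \<open>c\<close> and \<open>a\<close>, \<open>c'\<close> still reaches
  \<open>H\<close>. Preceded by \<open>a, c\<close> this is an ear with at least two inner vertices,
  hence with three.\<close>

lemma ear3_of_edge:
  assumes "c \<notin> H" "a \<in> H" "adj c a" "adj c c'" "c' \<notin> H"
  obtains r b where "ear H a [c, c', r] b"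
proof -
  obtain h where h: "h \<in> H" "h \<noteq> a" by (rule ex_other_in_H)
  have cc: "c \<noteq> c'" "c' \<noteq> a" "c \<noteq> h" using assms h adj_irrefl by auto
  obtain x xs b where x: "x \<in> {c'} - {c, a}" "b \<in> H - {c, a}"
      "set xs \<inter> ({c, a} \<union> {c'} \<union> H) = {}" "distinct xs" "successively adj (x # xs @ [b])"
    by (rule path_avoiding[of "{c, a}" c' "{c'}" h H])
      (use assms h cc adj_V adj_V2 H_V in \<open>auto simp: card_insert_if\<close>)
  then have e: "ear H a (c # c' # xs) b"
    using assms cc adj_sym by (auto simp: ear_def)
  then have "length xs = 1" using ear_length by fastforce
  then obtain r where "xs = [r]" by (auto simp: length_Suc_conv)
  then show ?thesis using e that by blast
qed

text \<open>A neighbour of \<open>x\<close> in \<open>H\<close> would complete half of the ear to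
  one with two inner vertices.\<close>

lemma ear3_middle:
  assumes "ear H a [p, x, r] b"
  shows "\<forall>h\<in>H. \<not> adj x h"
proof (rule ballI, rule notI)
  fix h assume h: "h \<in> H" "adj x h"
  show False
  proof (cases "h = a")
    case False
    then have "ear H a [p, x] h" using assms h by (auto simp: ear_def)
    then show False using no_ear by fastforce
  next
    case True
    then have "ear H h [x, r] b" using assms h adj_sym by (auto simp: ear_def)
    then show False using no_ear by fastforce
  qed
qed

text \<open>After deletion of \<open>p\<close> and \<open>r\<close>, \<open>x\<close> still reaches
  \<open>H\<close>, though not in one step by \<open>ear3_middle\<close>. Preceded by
  \<open>a, p\<close> or by \<open>b, r\<close>, whichever end differs from \<open>h\<close>, this
  is an ear, so exactly one vertex \<open>q\<close> lies between.\<close>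

lemma ear3_third:
  assumes "ear H a [p, x, r] b"
  obtains q h where "q \<notin> {p, x, r}" "q \<notin> H" "adj x q" "h \<in> H" "adj q h"
proof -
  have e: "a \<in> H" "b \<in> H" "a \<noteq> b" "distinct [p,x,r]" "p \<notin> H" "x \<notin> H" "r \<notin> H" "adj a p" "adj p x"
      "adj x r" "adj r b"
    using assms by (auto simp: ear_def)
  obtain x' xs h where x: "x' \<in> {x} - {p, r}" "h \<in> H - {p, r}"
      "set xs \<inter> ({p, r} \<union> {x} \<union> H) = {}" "distinct xs" "successively adj (x' # xs @ [h])"
    by (rule path_avoiding[of "{p, r}" x "{x}" a H])
      (use e adj_V adj_V2 H_V in \<open>auto simp: card_insert_if\<close>)
  have ne: "xs \<noteq> []" using ear3_middle[OF assms] x by auto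
  have "length xs = 1"
  proof (cases "h = a")
    case False
    then have "ear H a (p # x # xs) h" using x e by (auto simp: ear_def)
    then show ?thesis using ear_length by fastforce
  next
    case True
    then have "ear H b (r # x # xs) h" using x e adj_sym by (auto simp: ear_def)
    then show ?thesis using ear_length by fastforce
  qed
  then obtain q where "xs = [q]" by (auto simp: length_Suc_conv)
  then show ?thesis using x by (intro that[of q h]) auto
qed

text \<open>
  The vertex \<open>x\<close> has a third neighbour \<open>q\<close>, adjacent to \<open>h \<in> H\<close>. A path from \<open>c\<close> to \<open>H \<union> {r, q}\<close> avoiding
  \<open>p\<close> and \<open>x\<close> completes to an ear with at least four inner vertices, unless \<open>h = b\<close> and the path ends in
  \<open>b\<close>. In that case the vertices \<open>p, x, r, q, v, w\<close> are not separated from \<open>H - {b}\<close> by \<open>{b, p}\<close>, and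
  any way out again completes to an ear that is too long.
\<close>

lemma ear3_end_neighbours:
  assumes "ear H a [p, x, r] b" "adj p c" "c \<notin> H"
  shows "c = x"
proof (rule ccontr)
  assume cx: "c \<noteq> x"
  have e: "a \<in> H" "b \<in> H" "a \<noteq> b" "p \<noteq> x" "x \<noteq> p" "p \<noteq> r" "r \<noteq> p" "x \<noteq> r" "r \<noteq> x" "p \<notin> H" "x \<notin> H" "r \<notin> H"
      "adj a p" "adj p a" "adj p x" "adj x p" "adj x r" "adj r x" "adj r b" "adj b r"
    using assms(1) adj_sym by (auto simp: ear_def)
  obtain q h where q: "q \<notin> {p, x, r}" "q \<notin> H" "adj x q" "h \<in> H" "adj q h"
    using ear3_third[OF assms(1)] by blast
  then have q': "adj q x" "adj h q" "q \<noteq> p" "p \<noteq> q" "q \<noteq> x" "x \<noteq> q" "q \<noteq> r" "r \<noteq> q" using adj_sym by auto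
  have cp: "adj c p" "c \<noteq> p" using assms adj_sym adj_irrefl by auto
  have cr: "c \<noteq> r"
  proof
    assume "c = r"
    then have "ear H a [p, r] b" using e assms by (auto simp: ear_def)
    then show False using no_ear by fastforce
  qed
  have cq: "c \<noteq> q"
  proof
    assume c: "c = q"
    show False
    proof (cases "h = a")
      case False
      then have "ear H a [p, q] h" using e q q' c assms by (auto simp: ear_def)
      then show False using no_ear by fastforce
    next
      case True
      then have "ear H b [r, x, q, p] a" using e q q' c cp by (auto simp: ear_def)
      then show False using no_ear by fastforce
    qed
  qed
  obtain c' ws t where w: "c' \<in> {c} - {p, x}" "t \<in> (H \<union> {r, q}) - {p, x}"
      "set ws \<inter> ({p, x} \<union> {c} \<union> (H \<union> {r, q})) = {}" "distinct ws" "successively adj (c' # ws @ [t])"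
    by (rule path_avoiding[of "{p, x}" c "{c}" a "H \<union> {r, q}"])
      (use e q cp cr cq cx assms adj_V adj_V2 H_V in \<open>auto simp: card_insert_if\<close>)
  define W where "W = c # ws"
  have W: "set W \<inter> ({p, x, r, q} \<union> H) = {}" "distinct W" "successively adj (p # W @ [t])"
      "W \<noteq> []" "length W \<ge> 1"
    using w cp cr cq cx assms by (auto simp: W_def)
  have W': "adj p (hd W)" "successively adj W" "adj (last W) t"
    using W by (auto simp: successively_Cons successively_append_iff)
  have ext: "successively adj (us @ p # W @ t # vs)"
    if "successively adj (us @ [p])" "successively adj (t # vs)" for us vs
    using W W' that by (auto simp: successively_Cons successively_append_iff)
  have "t \<noteq> r"
  proof
    assume t: "t = r"
    show False
    proof (cases "h = a")
      case False
      then have "ear H a (p # W @ [r, x, q]) h"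
        using e q q' W ext[of "[a]" "[x, q, h]"] t by (auto simp: ear_def)
      then show False using no_ear W by fastforce
    next
      case True
      then have "ear H a ([q, x, p] @ W @ [r]) b"
        using e q q' W ext[of "[a, q, x]" "[b]"] t by (auto simp: ear_def)
      then show False using no_ear W by fastforce
    qed
  qed
  moreover have "t \<noteq> q"
  proof
    assume t: "t = q"
    then have "ear H a (p # W @ [q, x, r]) b"
      using e q q' W ext[of "[a]" "[x, r, b]"] by (auto simp: ear_def)
    then show False using no_ear W by fastforce
  qed
  ultimately have tH: "t \<in> H" using w by blast
  have tb: "t = b"
  proof (rule ccontr)
    assume "t \<noteq> b"
    then have "ear H b ([r, x, p] @ W) t"
      using e q q' W ext[of "[b, r, x]" "[]"] tH by (auto simp: ear_def)
    then show False using no_ear W by fastforce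
  qed
  have hb: "h = b"
  proof (rule ccontr)
    assume "h \<noteq> b"
    then have "ear H h ([q, x, p] @ W) b"
      using e q q' W ext[of "[h, q, x]" "[]"] tb by (auto simp: ear_def)
    then show False using no_ear W by fastforce
  qed
  have "ear H a (p # W) b"
    using e q q' W ext[of "[a]" "[]"] tb by (auto simp: ear_def)
  \<comment> \<open>The ear has \<open>1 + length W\<close> inner vertices, and \<open>W\<close> is
    nonempty.\<close>
  then have "length W = 2" using ear_length W by fastforce
  then obtain v w where vw: "W = [v, w]" by (auto simp: length_Suc_conv numeral_2_eq_2)
  have vw': "v \<noteq> w" "w \<noteq> v" "v \<notin> {p, x, r, q}" "w \<notin> {p, x, r, q}" "v \<notin> H" "w \<notin> H" "adj p v" "adj v p"
      "adj v w" "adj w v" "adj w b" "adj b w"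
    using W vw tb adj_sym by auto
  obtain z us h' where z: "z \<in> {x, r, q, v, w} - {b, p}" "h' \<in> H - {b, p}"
      "set us \<inter> ({b, p} \<union> {x, r, q, v, w} \<union> H) = {}" "distinct us" "successively adj (z # us @ [h'])"
    by (rule path_avoiding[of "{b, p}" x "{x, r, q, v, w}" a H])
      (use e q vw' adj_V adj_V2 H_V in \<open>auto simp: card_insert_if\<close>)
  have E: "successively adj (ys @ z # us @ [h'])" if "successively adj (ys @ [z])" for ys
    using that z(5) by (auto simp: successively_append_iff)
  have L: "\<not> ear H b (y1 # y2 # y3 # y4 # ys @ us) h'" for y1 y2 y3 y4 ys
    using no_ear by fastforce
  note defs = e q q' z vw' hb
  \<comment> \<open>The vertices \<open>b, w, v, p, x, r\<close> form a cycle, and \<open>q\<close>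
    is adjacent to \<open>x\<close>. In each case one direction from \<open>b\<close> passes at
    least four inner vertices up to and including \<open>z\<close>.\<close>
  consider "z = x" | "z = r" | "z = q" | "z = v" | "z = w" using z by blast
  then show False
  proof cases
    case 1
    then have "ear H b (w # v # p # x # [] @ us) h'"
      using defs E[of "[b, w, v, p]"] by (auto simp: ear_def)
    then show False using L by blast
  next
    case 2
    then have "ear H b (w # v # p # x # [r] @ us) h'"
      using defs E[of "[b, w, v, p, x]"] by (auto simp: ear_def)
    then show False using L by blast
  next
    case 3
    then have "ear H b (w # v # p # x # [q] @ us) h'"
      using defs E[of "[b, w, v, p, x]"] by (auto simp: ear_def)
    then show False using L by blast
  next
    case 4
    then have "ear H b (r # x # p # v # [] @ us) h'"
      using defs E[of "[b, r, x, p]"] by (auto simp: ear_def)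
    then show False using L by blast
  next
    case 5
    then have "ear H b (r # x # p # v # [w] @ us) h'"
      using defs E[of "[b, r, x, p, v]"] by (auto simp: ear_def)
    then show False using L by blast
  qed
qed

text \<open>For \<open>y\<close> other than \<open>p\<close> and \<open>r\<close>, a way from
  \<open>y\<close> to \<open>H\<close> avoiding \<open>x\<close> and \<open>p\<close> cannot enter
  \<open>r\<close>, whose only outer neighbour is \<open>x\<close>. Appended to half of the ear it
  gives at least three inner vertices, so \<open>y\<close> reaches \<open>H\<close> in one
  step.\<close>

lemma ear3_middle_neighbours:
  assumes "ear H a [p, x, r] b" "adj x y"
  shows "y \<notin> H" "\<exists>h\<in>H. adj y h"
proof -
  have e: "a \<in> H" "b \<in> H" "a \<noteq> b" "p \<noteq> x" "x \<noteq> p" "p \<noteq> r" "r \<noteq> p" "x \<noteq> r" "r \<noteq> x" "p \<notin> H" "x \<notin> H" "r \<notin> H"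
      "adj a p" "adj p a" "adj p x" "adj x p" "adj x r" "adj r x" "adj r b" "adj b r"
    using assms(1) adj_sym by (auto simp: ear_def)
  show yH: "y \<notin> H" using ear3_middle[OF assms(1)] assms(2) by blast
  have rN: "c = x" if "adj r c" "c \<notin> H" for c
    using ear3_end_neighbours[of b r x p a c] ear_rev[OF assms(1)] that by simp
  show "\<exists>h\<in>H. adj y h"
  proof (cases "y = p \<or> y = r")
    case True
    then show ?thesis using e by blast
  next
    case False
    have yx: "y \<noteq> x" using assms adj_irrefl by blast
    \<comment> \<open>With \<open>r\<close> among the targets, \<open>ws\<close> avoids
      \<open>r\<close>, as the ear from \<open>b\<close> through \<open>r\<close> in the case
      \<open>t = a\<close> requires.\<close>
    obtain y' ws t where w: "y' \<in> {y} - {x, p}" "t \<in> insert r H - {x, p}"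
        "set ws \<inter> ({x, p} \<union> {y} \<union> insert r H) = {}" "distinct ws" "successively adj (y' # ws @ [t])"
      by (rule path_avoiding[of "{x, p}" y "{y}" a "insert r H"])
        (use e False yx yH assms adj_V adj_V2 H_V in \<open>auto simp: card_insert_if\<close>)
    have last: "adj (last (y # ws)) t"
      using w by (auto simp: successively_Cons successively_append_iff split: if_splits)
    have "t \<noteq> r"
    proof
      assume "t = r"
      then have "last (y # ws) = x" using rN[of "last (y # ws)"] last adj_sym w yH
        by (metis IntI UnCI disjoint_iff insertCI last_ConsL last_ConsR last_in_set)
      then show False using w yx by (metis IntI UnCI empty_iff insertI1 last_ConsL last_ConsR last_in_set)
    qed
    then have t: "t \<in> H" using w by blast
    have "ws = []"
    proof (cases "t = a")
      case False
      then have "ear H a (p # x # y # ws) t" using e w t yH yx \<open>\<not> (y = p \<or> y = r)\<close> assms by (auto simp: ear_def)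
      then show ?thesis using ear_length by fastforce
    next
      case True
      then have "ear H b (r # x # y # ws) t" using e w t yH yx \<open>\<not> (y = p \<or> y = r)\<close> assms by (auto simp: ear_def)
      then show ?thesis using ear_length by fastforce
    qed
    then show ?thesis using w t by auto
  qed
qed

text \<open>The outer neighbour \<open>x\<close> makes \<open>c\<close> the first inner vertex of an
  ear with three of them, and \<open>ear3_end_neighbours\<close> applies.\<close>

lemma leaf_outer_neighbour:
  assumes "c \<notin> H" "a \<in> H" "adj c a" "adj c x" "x \<notin> H" "adj c y" "y \<notin> H"
  shows "x = y"
proof -
  obtain r b where "ear H a [c, x, r] b" using ear3_of_edge assms by blast
  then show ?thesis using ear3_end_neighbours assms by blast
qed

lemma leaf_two_neighbours:
  assumes "c \<notin> H" "a \<in> H" "adj c a"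
  obtains f g where "f \<in> H" "g \<in> H" "f \<noteq> g" "adj c f" "adj c g"
proof -
  let ?N = "{y. adj c y}"
  have "card (?N - H) \<le> 1"
    by (rule card_le_Suc0_iff_eq[THEN iffD2, folded One_nat_def])
      (use assms leaf_outer_neighbour fin adj_V2 in \<open>auto intro: finite_subset[of _ V]\<close>)
  moreover have "card ?N \<ge> 3" using card_neighbours assms adj_V by blast
  moreover have "card ?N = card (?N \<inter> H) + card (?N - H)"
    using fin adj_V2 by (subst card_Un_disjoint[symmetric]) (auto intro: finite_subset[of _ V] arg_cong[of _ _ card])
  ultimately have "card (?N \<inter> H) \<ge> 2" by linarith
  then obtain f g where "f \<in> ?N \<inter> H" "g \<in> ?N \<inter> H" "f \<noteq> g"
    by (metis card_le_Suc0_iff_eq not_less_eq_eq numeral_2_eq_2 card.infinite le0)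
  then show ?thesis using that by blast
qed

text \<open>It suffices that \<open>x\<close> is the middle of an ear with three inner vertices. On
  a path from \<open>x\<close> to \<open>H\<close> with last outer vertices \<open>d, c\<close>, the
  vertex \<open>d\<close> is such a middle. If \<open>d\<close> were not \<open>x\<close>, its
  predecessor \<open>g\<close> would have a neighbour in \<open>H\<close>, hence differ from
  \<open>x\<close>, and so have two outer neighbours, \<open>d\<close> and its own predecessor
  \<open>v\<close>.\<close>

lemma centre_neighbours:
  assumes "x \<in> V - H" "\<forall>h\<in>H. \<not> adj x h" "adj x y"
  shows "y \<notin> H" "\<exists>h\<in>H. adj y h"
proof -
  obtain k where k: "k \<in> H" using ex_other_in_H by blast
  obtain x' xs h where x: "x' \<in> {x} - {}" "h \<in> H - {}"
      "set xs \<inter> ({} \<union> {x} \<union> H) = {}" "distinct xs" "successively adj (x' # xs @ [h])"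
    by (rule path_avoiding[of "{}" x "{x}" k H]) (use assms k H_V in auto)
  have "xs \<noteq> []" using x assms by auto
  then obtain ys c where xs: "xs = ys @ [c]" by (metis rev_exhaust)
  have c: "c \<notin> H" "adj c h" "h \<in> H" using x xs by (auto simp: successively_append_iff successively_Cons)
  \<comment> \<open>\<open>last (x # ys)\<close> also covers \<open>ys = []\<close>, where
    \<open>d\<close> is \<open>x\<close>; likewise for \<open>g\<close> and \<open>v\<close>
    below.\<close>
  define d where "d = last (x # ys)"
  have d_in: "d \<in> insert x (set ys)" by (auto simp: d_def)
  have d: "adj d c" "d \<notin> H" using x xs assms d_in
      by (auto simp: d_def successively_Cons successively_append_iff simp del: last.simps)
        (auto split: if_splits)
  obtain r b where e: "ear H h [c, d, r] b" using ear3_of_edge c d adj_sym by blast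
  have "ys = []"
  proof (rule ccontr)
    assume ne: "ys \<noteq> []"
    then obtain zs where ys: "ys = zs @ [d]" by (simp add: d_def) (metis append_butlast_last_id)
    define g where "g = last (x # zs)"
    have g_in: "g \<in> insert x (set zs)" by (auto simp: g_def)
    have g: "adj g d" "g \<notin> H" using x xs ys assms g_in
      by (auto simp: g_def successively_Cons successively_append_iff simp del: last.simps)
        (auto split: if_splits)
    obtain k' where k': "k' \<in> H" "adj g k'" using ear3_middle_neighbours[OF e] g adj_sym by blast
    then have "zs \<noteq> []" using assms g_def by auto
    then obtain us where zs: "zs = us @ [g]" by (simp add: g_def) (metis append_butlast_last_id)
    define v where "v = last (x # us)"
    have v_in: "v \<in> insert x (set us)" by (auto simp: v_def)
    have v: "adj v g" "v \<notin> H" using x xs ys zs assms v_in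
      by (auto simp: v_def successively_Cons successively_append_iff simp del: last.simps)
        (auto split: if_splits)
    have "v = d" using leaf_outer_neighbour[of g k' v d] g k' v adj_sym d by blast
    then show False using x xs ys zs v_in by auto
  qed
  then have "d = x" by (simp add: d_def)
  then show "y \<notin> H" "\<exists>h\<in>H. adj y h" using ear3_middle_neighbours[OF e] assms by blast+
qed

end

section \<open>Rainbow walks\<close>

text \<open>Walks concatenate as soon as their color sets are disjoint, so the relation records the
  exact color set. Repeated vertices are removed only in
  \<open>rainbow_walk_imp_path\<close>.\<close>

inductive rainbow_walk :: "('a \<Rightarrow> 'a \<Rightarrow> bool) \<Rightarrow> ('a set \<Rightarrow> nat) \<Rightarrow> 'a \<Rightarrow> nat set \<Rightarrow> 'a \<Rightarrow> bool"
  for A c where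
  Nil: "rainbow_walk A c u {} u"
| Cons: "\<lbrakk>A u w; c {u, w} \<notin> F; rainbow_walk A c w F v\<rbrakk>
    \<Longrightarrow> rainbow_walk A c u (insert (c {u, w}) F) v"

text \<open>Source of the constant 3/5: equality holds at \<open>k = 5\<close>, while
  \<open>k = 1\<close> and \<open>k = 3\<close> fail with 5 > 3 and 10 > 9.\<close>

lemma ear_color_count:
  fixes k :: nat
  assumes "k \<noteq> 1" "k \<noteq> 3"
  shows "5 * ((k + 1) div 2) \<le> 3 * k"
proof (cases "k \<ge> 5")
  case True
  then show ?thesis using div_times_less_eq_dividend[of "k + 1" 2] by linarith
next
  case False
  then have "k = 0 \<or> k = 2 \<or> k = 4" using assms by linarith
  then show ?thesis by auto
qed

lemma rainbow_walk_single: "A u v \<Longrightarrow> rainbow_walk A c u {c {u, v}} v"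
  using rainbow_walk.Cons[OF _ _ rainbow_walk.Nil] by fastforce

lemma rainbow_walk_trans:
  assumes "rainbow_walk A c u F v" "rainbow_walk A c v F' w" "F \<inter> F' = {}"
  shows "rainbow_walk A c u (F \<union> F') w"
  using assms
proof (induction rule: rainbow_walk.induct)
  case (Cons u x F v)
  then have "rainbow_walk A c u (insert (c {u, x}) (F \<union> F')) w"
    by (intro rainbow_walk.Cons) auto
  then show ?case by simp
qed simp

lemma rainbow_walk_sym:
  assumes "rainbow_walk A c u F v" "\<And>x y. A x y \<Longrightarrow> A y x"
  shows "rainbow_walk A c v F u"
  using assms
proof (induction rule: rainbow_walk.induct)
  case (Cons u x F v)
  have "rainbow_walk A c v (F \<union> {c {x, u}}) u"
    using Cons by (intro rainbow_walk_trans[OF _ rainbow_walk_single]) (auto simp: insert_commute)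
  then show ?case by (simp add: insert_commute)
qed (rule rainbow_walk.Nil)

lemma rainbow_walk_mono:
  assumes "rainbow_walk A c u F v" "\<And>x y. A x y \<Longrightarrow> A' x y \<and> c' {x, y} = c {x, y}"
  shows "rainbow_walk A' c' u F v"
  using assms
proof (induction rule: rainbow_walk.induct)
  case (Cons u x F v)
  then show ?case using rainbow_walk.Cons[of A' u x c' F v] by metis
qed (rule rainbow_walk.Nil)

lemma rainbow_walk_colors:
  assumes "rainbow_walk A c u F v" "\<And>e. c e < m"
  shows "F \<subseteq> {..<m}"
  using assms by (induction rule: rainbow_walk.induct) auto

lemma rainbow_walk_segment:
  assumes "\<And>i. i < K \<Longrightarrow> A (q i) (q (Suc i)) \<and> c {q i, q (Suc i)} = col i"
    and "inj_on col {i..<j}" "i \<le> j" "j \<le> K"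
  shows "rainbow_walk A c (q i) (col ` {i..<j}) (q j)"
  using assms(3,2,4)
proof (induction rule: dec_induct)
  case base
  then show ?case by (simp add: rainbow_walk.Nil)
next
  case (step n)
  have eq: "{i..<Suc n} = insert n {i..<n}" using step by auto
  have "rainbow_walk A c (q i) (col ` {i..<n} \<union> {col n}) (q (Suc n))"
    using step assms(1)[of n] rainbow_walk_single[of A "q n" "q (Suc n)" c]
    by (intro rainbow_walk_trans) (auto simp: eq)
  then show ?case by (simp add: eq)
qed

section \<open>Rainbow connected sets and the addition of an ear\<close>

context three_connected
begin

abbreviation adj_in :: "'a set \<Rightarrow> 'a \<Rightarrow> 'a \<Rightarrow> bool" where
  "adj_in H \<equiv> (\<lambda>x y. adj x y \<and> x \<in> H \<and> y \<in> H)"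

definition joined :: "'a set \<Rightarrow> ('a set \<Rightarrow> nat) \<Rightarrow> 'a \<Rightarrow> 'a \<Rightarrow> bool" where
  "joined H c u v \<longleftrightarrow> (\<exists>F. rainbow_walk (adj_in H) c u F v)"

text \<open>Bounding \<open>c\<close> on all sets, not just on edges, passes the bound to every walk
  without side conditions.\<close>

definition rainbow_set :: "'a set \<Rightarrow> ('a set \<Rightarrow> nat) \<Rightarrow> nat \<Rightarrow> bool" where
  "rainbow_set H c m \<longleftrightarrow> (\<forall>e. c e < m) \<and> (\<forall>u\<in>H. \<forall>v\<in>H. joined H c u v)"

lemma adj_in_sym: "adj_in H x y \<Longrightarrow> adj_in H y x"
  using adj_sym by blast

lemma joinedI: "rainbow_walk (adj_in H) c u F v \<Longrightarrow> joined H c u v"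
  unfolding joined_def by (rule exI)

lemma joined_refl: "joined H c u u"
  by (rule joinedI[OF rainbow_walk.Nil])

lemma rainbow_walk_adj_in_sym:
  assumes "rainbow_walk (adj_in H) c u F v"
  shows "rainbow_walk (adj_in H) c v F u"
  by (rule rainbow_walk_sym[OF assms adj_in_sym])

lemma joined_sym: "joined H c u v \<Longrightarrow> joined H c v u"
  unfolding joined_def by (elim exE) (rule exI, erule rainbow_walk_adj_in_sym)

text \<open>Enter \<open>H\<close> with new colors, cross it with colors below \<open>m\<close>, and
  leave it with other new colors.\<close>

lemma rainbow_walk_via:
  assumes H: "rainbow_set H c m" "H \<subseteq> H'" "\<And>x y. adj_in H x y \<Longrightarrow> c' {x, y} = c {x, y}"
    and s: "rainbow_walk (adj_in H') c' s F h" "h \<in> H"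
    and t: "rainbow_walk (adj_in H') c' t F' h'" "h' \<in> H"
    and disj: "F \<inter> F' = {}" "\<And>k. k \<in> F \<union> F' \<Longrightarrow> k \<ge> m"
  shows "joined H' c' s t"
proof -
  obtain E where E: "rainbow_walk (adj_in H) c h E h'" using H(1) s(2) t(2)
    unfolding rainbow_set_def joined_def by blast
  have Em: "E \<subseteq> {..<m}" using rainbow_walk_colors[OF E] H(1) by (auto simp: rainbow_set_def)
  have E': "rainbow_walk (adj_in H') c' h E h'"
    by (rule rainbow_walk_mono[OF E]) (use H in auto)
  have t': "rainbow_walk (adj_in H') c' h' F' t"
    using t(1) by (rule rainbow_walk_adj_in_sym)
  have "rainbow_walk (adj_in H') c' h (E \<union> F') t"
    by (rule rainbow_walk_trans[OF E' t']) (use Em disj in force)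
  then have "rainbow_walk (adj_in H') c' s (F \<union> (E \<union> F')) t"
    by (rule rainbow_walk_trans[OF s(1)]) (use Em disj in force)
  then show ?thesis by (rule joinedI)
qed

text \<open>
  With \<open>k\<close> the number of inner vertices, the edges of the ear are colored
  \<open>x\<^sub>1 \<dots> x\<^sub>j x\<^sub>1 \<dots> x\<^sub>j\<close> with \<open>j = \<lceil>k / 2\<rceil>\<close> new colors, where for even \<open>k\<close> an old color is
  inserted in the middle. Two vertices of the ear at distance at most \<open>d = k + 1 - j\<close> are joined
  inside the ear, all others through \<open>H\<close>.
\<close>

lemma rainbow_set_ear:
  assumes H: "rainbow_set H c m" "m > 0" and ear: "ear H a xs b"
  shows "\<exists>c'. rainbow_set (H \<union> set xs) c' (m + (length xs + 1) div 2)"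
proof -
  define qs where "qs = a # xs @ [b]"
  define q where "q i = qs ! i" for i
  define K where "K = length xs + 1"
  define j where "j = (length xs + 1) div 2"
  define d where "d = K - j"
  define col where "col i = (if i < j then m + i else if i < d then 0 else m + (i - d))" for i
  define H' where "H' = H \<union> set xs"
  have e: "a \<in> H" "b \<in> H" "a \<noteq> b" "xs \<noteq> []" "set xs \<inter> H = {}" "distinct xs" "successively adj qs"
    using ear by (auto simp: ear_def qs_def)
  have arith: "K \<ge> 2" "j > 0" "d \<le> j + 1" "j \<le> d" "K = d + j"
    using e(4) by (cases xs; simp add: K_def j_def d_def)+
  have dist: "distinct qs" "length qs = K + 1" using e by (auto simp: qs_def K_def)
  have q0: "q 0 = a" "q K = b" by (auto simp: q_def qs_def K_def nth_append)
  have q_inner: "q i \<in> set xs" if "0 < i" "i < K" for i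
    using that by (cases i) (auto simp: q_def qs_def K_def nth_append)
  have q_H': "q i \<in> H'" if "i \<le> K" for i
    using that q0 q_inner[of i] e by (cases "i = 0 \<or> i = K") (auto simp: H'_def)
  have q_adj: "adj (q i) (q (Suc i))" if "i < K" for i
    using e(7) that dist(2) by (simp add: successively_conv_nth q_def)
  have q_inj: "i = i'" if "q i = q i'" "i \<le> K" "i' \<le> K" for i i'
    using that dist by (simp add: q_def nth_eq_iff_index_eq)
  have ears: "\<exists>i\<le>K. 0 < i \<and> i < K \<and> v = q i" if v: "v \<in> set xs" for v
  proof -
    obtain i where "i < length xs" "v = xs ! i" using v by (metis in_set_conv_nth)
    then show ?thesis by (intro exI[of _ "Suc i"]) (auto simp: q_def qs_def K_def nth_append)
  qed
  \<comment> \<open>The index of an ear edge is unique, so \<open>SOME\<close> finds it. No ear edge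
    lies inside \<open>H\<close>, as each has an inner vertex; remaining edges get the old color
    0.\<close>
  define c' where "c' = (\<lambda>E. if E \<subseteq> H then c E
    else if \<exists>i<K. E = {q i, q (Suc i)} then col (SOME i. i < K \<and> E = {q i, q (Suc i)}) else 0)"
  have col_less: "col i < m + j" if "i < K" for i
    using that arith H(2) by (auto simp: col_def)
  have c'_col: "c' {q i, q (Suc i)} = col i" if i: "i < K" for i
  proof -
    have "(SOME i'. i' < K \<and> {q i, q (Suc i)} = {q i', q (Suc i')}) = i"
    proof (rule some_equality)
      fix i' assume i': "i' < K \<and> {q i, q (Suc i)} = {q i', q (Suc i')}"
      then show "i' = i" using q_inj[of i i'] q_inj[of i "Suc i'"] q_inj[of "Suc i" i'] i
        by (auto simp: doubleton_eq_iff)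
    qed (use i in simp)
    moreover have "\<not> {q i, q (Suc i)} \<subseteq> H"
      using q_inner[of i] q_inner[of "Suc i"] i arith(1) e(5) by (cases i) auto
    ultimately show ?thesis using i by (auto simp: c'_def)
  qed
  have c'_old: "c' {x, y} = c {x, y}" if "adj_in H x y" for x y
    using that by (simp add: c'_def)
  have c'_less: "c' E < m + j" for E
  proof (cases "\<exists>i<K. E = {q i, q (Suc i)} \<and> \<not> E \<subseteq> H")
    case True
    then show ?thesis using c'_col col_less by metis
  next
    case False
    then show ?thesis using H by (auto simp: c'_def rainbow_set_def intro: trans_less_add1)
  qed
  have seg: "rainbow_walk (adj_in H') c' (q i) (col ` {i..<i'}) (q i')"
    if "inj_on col {i..<i'}" "i \<le> i'" "i' \<le> K" for i i'
    by (rule rainbow_walk_segment[where K = K]) (use that q_adj q_H' c'_col in auto)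
  have segr: "rainbow_walk (adj_in H') c' (q i') (col ` {i..<i'}) (q i)"
    if "inj_on col {i..<i'}" "i \<le> i'" "i' \<le> K" for i i'
    using seg[OF that] by (rule rainbow_walk_adj_in_sym)
  have left: "rainbow_walk (adj_in H') c' (q i) (col ` {0..<i}) a" if "i \<le> j" for i
  proof -
    have "inj_on col {0..<i}" using that arith by (intro inj_onI) (auto simp: col_def)
    then show ?thesis using segr[of 0 i] that arith q0 by simp
  qed
  have right: "rainbow_walk (adj_in H') c' (q i) (col ` {i..<K}) b" if "d \<le> i" "i \<le> K" for i
  proof -
    have "inj_on col {i..<K}" using that arith by (intro inj_onI) (auto simp: col_def)
    then show ?thesis using seg[of i K] that q0 by simp
  qed
  have via: "joined H' c' s t"
    if "rainbow_walk (adj_in H') c' s F h" "h \<in> H" "rainbow_walk (adj_in H') c' t F' h'" "h' \<in> H"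
      "F \<inter> F' = {}" "\<And>k. k \<in> F \<union> F' \<Longrightarrow> k \<ge> m" for s F h t F' h'
    by (rule rainbow_walk_via[OF H(1) _ c'_old that]) (auto simp: H'_def)
  have in_ear: "joined H' c' (q s) (q t)" if st: "s \<le> t" "0 < s" "t < K" for s t
  proof (cases "t - s \<le> d")
    case True
    \<comment> \<open>Equal colors on the ear occur only at index distance exactly
      \<open>d\<close>.\<close>
    have "inj_on col {s..<t}"
      using True st arith H(2) by (auto simp: inj_on_def col_def split: if_splits)
    then show ?thesis using seg[of s t] st by (intro joinedI) auto
  next
    case False
    \<comment> \<open>Now \<open>s < t - d\<close>: the way back to \<open>a\<close> uses colors
      \<open>m + i\<close> with \<open>i < s\<close>, the way on to \<open>b\<close> those with
      \<open>i \<ge> t - d\<close>.\<close>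
    show ?thesis
      by (rule via[OF left _ right]) (use False st arith e in \<open>auto simp: col_def\<close>)
  qed
  \<comment> \<open>Since \<open>d \<le> j + 1\<close>, an inner vertex has \<open>s \<le> j\<close>
    or \<open>s \<ge> d\<close>, so some way to an end avoids the old color in the middle.\<close>
  have to_H: "joined H' c' (q s) h" if "0 < s" "s < K" "h \<in> H" for s h
  proof (cases "s \<le> j")
    case True
    show ?thesis
      by (rule via[OF left _ rainbow_walk.Nil]) (use True that arith e in \<open>auto simp: col_def\<close>)
  next
    case False
    show ?thesis
      by (rule via[OF right _ rainbow_walk.Nil]) (use False that arith e in \<open>auto simp: col_def\<close>)
  qed
  have "joined H' c' u v" if uv: "u \<in> H'" "v \<in> H'" for u v
  proof -
    consider "u \<in> H" "v \<in> H" | "u \<in> H" "v \<in> set xs" | "u \<in> set xs" "v \<in> H" | "u \<in> set xs" "v \<in> set xs"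
      using uv unfolding H'_def by blast
    then show ?thesis
    proof cases
      case 1
      then show ?thesis using via[OF rainbow_walk.Nil _ rainbow_walk.Nil] by auto
    next
      case 2
      then show ?thesis using ears to_H joined_sym by metis
    next
      case 3
      then show ?thesis using ears to_H by metis
    next
      case 4
      then obtain s t where "u = q s" "v = q t" "0 < s" "0 < t" "s < K" "t < K" using ears by metis
      then show ?thesis using in_ear[of s t] in_ear[of t s] joined_sym by (metis nat_le_linear)
    qed
  qed
  then show ?thesis using c'_less by (auto simp: rainbow_set_def H'_def j_def)
qed

end

section \<open>Coloring the remainder\<close>

context ear_restricted
begin

text \<open>Single-vertex components outside \<open>H\<close> count as leaves too.\<close>

definition leaves :: "'a set" where
  "leaves = {l \<in> V - H. \<exists>h\<in>H. adj l h}"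

definition centres :: "'a set" where
  "centres = {z \<in> V - H. \<forall>h\<in>H. \<not> adj z h}"

lemma centre_leaves: "\<lbrakk>z \<in> centres; adj z y\<rbrakk> \<Longrightarrow> y \<in> leaves"
  using centre_neighbours[of z y] adj_V2[of z y] by (simp add: leaves_def centres_def)

lemma centre_two_leaves:
  assumes "z \<in> centres"
  obtains u v where "u \<in> leaves" "v \<in> leaves" "u \<noteq> v" "adj z u" "adj z v"
proof -
  have "card {y. adj z y} \<ge> 3" using card_neighbours assms by (simp add: centres_def)
  then obtain u v where "adj z u" "adj z v" "u \<noteq> v"
    by (metis card_le_Suc0_iff_eq mem_Collect_eq not_less_eq_eq numeral_3_eq_3 card.infinite le0 Suc_leD)
  then show ?thesis using that centre_leaves[OF assms] by blast
qed

text \<open>Each leaf enters \<open>H\<close> by an edge colored \<open>X\<close> or one colored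
  \<open>Y\<close>, each centre by \<open>Z, X\<close> or by \<open>W, Y\<close>; two vertices take
  opposite options. Colors may coincide where there is only one leaf or centre, which saves colors
  in small cases.\<close>

lemma rainbow_set_remainder:
  assumes c: "rainbow_set H c m" "m > 0"
    and bounds: "{X, Y, Z, W} \<subseteq> {m..<M} \<or> leaves = {}" "m \<le> M"
    and XY: "\<And>l l'. \<lbrakk>l \<in> leaves; l' \<in> leaves; l \<noteq> l'\<rbrakk> \<Longrightarrow> X \<noteq> Y"
    and ZW: "centres \<noteq> {} \<Longrightarrow> {Z, W} \<inter> {X, Y} = {}"
    and ZW': "\<And>z z'. \<lbrakk>z \<in> centres; z' \<in> centres; z \<noteq> z'\<rbrakk> \<Longrightarrow> Z \<noteq> W"
  shows "\<exists>c'. rainbow_set V c' M"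
proof -
  have "\<forall>l\<in>leaves. \<exists>f g. f \<in> H \<and> g \<in> H \<and> f \<noteq> g \<and> adj l f \<and> adj l g"
    using leaf_two_neighbours unfolding leaves_def by blast
  then obtain f g where fg: "\<And>l. l \<in> leaves \<Longrightarrow> f l \<in> H \<and> g l \<in> H \<and> f l \<noteq> g l \<and> adj l (f l) \<and> adj l (g l)"
    by metis
  have "\<forall>z\<in>centres. \<exists>u v. u \<in> leaves \<and> v \<in> leaves \<and> u \<noteq> v \<and> adj z u \<and> adj z v"
    using centre_two_leaves by metis
  then obtain u v where uv: "\<And>z. z \<in> centres \<Longrightarrow> u z \<in> leaves \<and> v z \<in> leaves \<and> u z \<noteq> v z \<and> adj z (u z) \<and> adj z (v z)"
    by metis
  have parts: "V = H \<union> leaves \<union> centres" "leaves \<inter> H = {}" "centres \<inter> H = {}" "leaves \<inter> centres = {}"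
    using H_V by (auto simp: leaves_def centres_def)
  have bnd: "{X, Y, Z, W} \<subseteq> {m..<M}" if "l \<in> leaves" for l using bounds that by auto
  \<comment> \<open>The cases do not clash: \<open>f l \<noteq> g l\<close>,
    \<open>u z \<noteq> v z\<close>, and edges at centres do not meet \<open>H\<close>.\<close>
  define c' where "c' = (\<lambda>E. if E \<subseteq> H then c E
    else if \<exists>l\<in>leaves. E = {l, f l} then X
    else if \<exists>l\<in>leaves. E = {l, g l} then Y
    else if \<exists>z\<in>centres. E = {z, u z} then Z
    else if \<exists>z\<in>centres. E = {z, v z} then W else 0)"
  have c'_old: "c' {x, y} = c {x, y}" if "adj_in H x y" for x y
    using that by (simp add: c'_def)
  have cX: "c' {l, f l} = X" and cY: "c' {l, g l} = Y" if l: "l \<in> leaves" for l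
  proof -
    have "\<not> {l, y} \<subseteq> H" for y using l parts by auto
    moreover have "\<not> (\<exists>l'\<in>leaves. {l, g l} = {l', f l'})"
      using fg l parts by (fastforce simp: doubleton_eq_iff)
    moreover have "\<exists>l'\<in>leaves. {l, f l} = {l', f l'}" "\<exists>l'\<in>leaves. {l, g l} = {l', g l'}"
      using l by blast+
    ultimately show "c' {l, f l} = X" "c' {l, g l} = Y" unfolding c'_def by presburger+
  qed
  have cZ: "c' {z, u z} = Z" and cW: "c' {z, v z} = W" if z: "z \<in> centres" for z
  proof -
    have "\<not> (\<exists>l\<in>leaves. {z, y} = {l, f l}) \<and> \<not> (\<exists>l\<in>leaves. {z, y} = {l, g l})" for y
      using fg z parts by (auto simp: doubleton_eq_iff)
    moreover have "\<not> (\<exists>z'\<in>centres. {z, v z} = {z', u z'})"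
    proof
      assume "\<exists>z'\<in>centres. {z, v z} = {z', u z'}"
      then obtain z' where z': "z' \<in> centres" "{z, v z} = {z', u z'}" by blast
      moreover have "z \<noteq> u z'" using uv[OF z'(1)] z parts by auto
      ultimately show False using uv[OF z] by (auto simp: doubleton_eq_iff)
    qed
    moreover have "\<not> {z, y} \<subseteq> H" for y using z parts by auto
    moreover have "\<exists>z'\<in>centres. {z, u z} = {z', u z'}" "\<exists>z'\<in>centres. {z, v z} = {z', v z'}"
      using z by blast+
    ultimately show "c' {z, u z} = Z" "c' {z, v z} = W" unfolding c'_def by presburger+
  qed
  have c'_less: "c' E < M" for E
  proof -
    have "c E < M" using c(1) bounds(2) by (auto simp: rainbow_set_def intro: less_le_trans)
    \<comment> \<open>Without leaves the four colors, then unbounded, are never assigned.\<close>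
    moreover have "leaves = {} \<Longrightarrow> centres = {}" using uv by blast
    ultimately show ?thesis using bounds c(2) by (cases "leaves = {}") (simp_all add: c'_def)
  qed
  have wX: "rainbow_walk (adj_in V) c' l {X} (f l)" and wY: "rainbow_walk (adj_in V) c' l {Y} (g l)"
    if l: "l \<in> leaves" for l
    using fg[OF l] parts l rainbow_walk_single[of "adj_in V" l "f l" c'] cX[OF l]
      rainbow_walk_single[of "adj_in V" l "g l" c'] cY[OF l] by auto
  have wZ: "rainbow_walk (adj_in V) c' z {Z, X} (f (u z))" and wW: "rainbow_walk (adj_in V) c' z {W, Y} (g (v z))"
    if z: "z \<in> centres" for z
  proof -
    have Z: "Z \<noteq> X" "W \<noteq> Y" using ZW z by auto
    have "adj_in V z (u z)" "adj_in V z (v z)" using uv[OF z] adj_V adj_V2 by blast+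
    then have "rainbow_walk (adj_in V) c' z {Z} (u z)" "rainbow_walk (adj_in V) c' z {W} (v z)"
      using rainbow_walk_single[of "adj_in V" z "u z" c'] cZ[OF z]
      rainbow_walk_single[of "adj_in V" z "v z" c'] cW[OF z] by auto
    then show "rainbow_walk (adj_in V) c' z {Z, X} (f (u z))" "rainbow_walk (adj_in V) c' z {W, Y} (g (v z))"
      using rainbow_walk_trans[OF _ wX[of "u z"], of z "{Z}"] rainbow_walk_trans[OF _ wY[of "v z"], of z "{W}"]
        uv[OF z] Z by (auto simp: insert_commute)
  qed
  have via: "joined V c' s t"
    if "rainbow_walk (adj_in V) c' s F h" "rainbow_walk (adj_in V) c' t F' h'" "h \<in> H" "h' \<in> H"
      "F \<inter> F' = {}" "\<And>k. k \<in> F \<union> F' \<Longrightarrow> k \<ge> m" for s F h t F' h'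
    using rainbow_walk_via[OF c(1) H_V c'_old that(1,3,2,4,5,6)] .
  have HH: "joined V c' s t" if "s \<in> H" "t \<in> H" for s t
    by (rule via[OF rainbow_walk.Nil rainbow_walk.Nil]) (use that in auto)
  have LH: "joined V c' s t" if "s \<in> leaves" "t \<in> H" for s t
    by (rule via[OF wX rainbow_walk.Nil]) (use that bnd fg in auto)
  have CH: "joined V c' s t" if "s \<in> centres" "t \<in> H" for s t
    by (rule via[OF wZ rainbow_walk.Nil]) (use that bnd fg uv in auto)
  have LL: "joined V c' s t" if "s \<in> leaves" "t \<in> leaves" for s t
  proof (cases "s = t")
    case False
    show ?thesis
      by (rule via[OF wX wY]) (use that bnd fg XY False in auto)
  qed (simp add: joined_refl)
  have CL: "joined V c' s t" if "s \<in> centres" "t \<in> leaves" for s t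
    by (rule via[OF wZ wY]) (use that bnd fg uv XY ZW in fastforce)+
  have CC: "joined V c' s t" if "s \<in> centres" "t \<in> centres" for s t
  proof (cases "s = t")
    case False
    have "X \<noteq> Y" using uv[OF that(1)] XY by blast
    then have "{Z, X} \<inter> {W, Y} = {}" using ZW ZW'[OF that False] that by blast
    then show ?thesis
      by (rule via[OF wZ[OF that(1)] wW[OF that(2)], rotated 2]) (use that bnd fg uv in auto)
  qed (simp add: joined_refl)
  have "joined V c' s t" if "s \<in> V" "t \<in> V" for s t
  proof -
    have "s \<in> H \<or> s \<in> leaves \<or> s \<in> centres" "t \<in> H \<or> t \<in> leaves \<or> t \<in> centres"
      using that parts by auto
    then show ?thesis using HH LH CH LL CL CC joined_sym by metis
  qed
  then show ?thesis using c'_less by (auto simp: rainbow_set_def)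
qed

text \<open>By \<open>m\<close>, \<open>t\<close> extra colors for \<open>s\<close> extra vertices
  are affordable if \<open>5 t \<le> 3 s + 4\<close>. Each centre brings three leaves of its own;
  equality occurs for two leaves and no centre.\<close>

lemma ex_remainder_coloring:
  assumes c: "rainbow_set H c m" "m > 0" and m: "5 * m + 1 \<le> 3 * card H"
  shows "\<exists>c' M. rainbow_set V c' M \<and> 5 * M \<le> 3 * (card V + 1)"
proof -
  have finLC: "finite leaves" "finite centres" using fin by (auto simp: leaves_def centres_def)
  have "V = H \<union> (leaves \<union> centres)" using H_V by (auto simp: leaves_def centres_def)
  moreover have "H \<inter> (leaves \<union> centres) = {}" "leaves \<inter> centres = {}" by (auto simp: leaves_def centres_def)
  moreover have "finite H" using H_V fin finite_subset by blast
  ultimately have cardV: "card V = card H + card leaves + card centres"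
    using finLC by (metis card_Un_disjoint finite_UnI add.assoc)
  let ?N = "\<lambda>z. {y. adj z y}"
  have N: "?N z \<subseteq> leaves" "card (?N z) \<ge> 3" if "z \<in> centres" for z
    using that centre_leaves card_neighbours[of z] by (auto simp: centres_def)
  \<comment> \<open>A common neighbour would be a leaf with two outer neighbours.\<close>
  have disj: "?N z \<inter> ?N z' = {}" if z: "z \<in> centres" "z' \<in> centres" "z \<noteq> z'" for z z'
  proof (rule ccontr)
    assume "?N z \<inter> ?N z' \<noteq> {}"
    then obtain y where y: "adj z y" "adj z' y" by auto
    then have "y \<in> leaves" using N z by blast
    then obtain h where "y \<notin> H" "h \<in> H" "adj y h" by (auto simp: leaves_def)
    then have "z = z'" using leaf_outer_neighbour[of y h z z'] y adj_sym z by (auto simp: centres_def)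
    then show False using z by simp
  qed
  have finish: ?thesis if "\<exists>c'. rainbow_set V c' M" "5 * M \<le> 3 * (card V + 1)" for M
    using that by blast
  consider "centres = {}" "leaves = {}" | "centres = {}" "card leaves = 1" | "centres = {}" "card leaves \<ge> 2"
    | "card centres = 1" | "card centres \<ge> 2"
    using finLC by (metis One_nat_def Suc_1 card_0_eq less_2_cases not_less)
  then show ?thesis
  proof cases
    case 1
    then have "\<exists>c'. rainbow_set V c' m"
      by (intro rainbow_set_remainder[OF c, where X = 0 and Y = 0 and Z = 0 and W = 0]) auto
    then show ?thesis by (rule finish) (use cardV m in auto)
  next
    case 2
    then have "\<exists>c'. rainbow_set V c' (m + 1)"
      \<comment> \<open>With one leaf \<open>X\<close> and \<open>Y\<close> may coincide;
        \<open>Z\<close> and \<open>W\<close> are dummies, there being no centre.\<close>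
      by (intro rainbow_set_remainder[OF c, where X = m and Y = m and Z = m and W = m])
        (auto simp: card_1_singleton_iff)
    then show ?thesis by (rule finish) (use cardV m 2 in auto)
  next
    case 3
    then have "\<exists>c'. rainbow_set V c' (m + 2)"
      by (intro rainbow_set_remainder[OF c, where X = m and Y = "m + 1" and Z = m and W = m]) auto
    then show ?thesis by (rule finish) (use cardV m 3 in auto)
  next
    case 4
    then obtain z where z: "centres = {z}" by (auto simp: card_1_singleton_iff)
    then have "card leaves \<ge> 3" using N[of z] card_mono[OF finLC(1), of "?N z"] by auto
    moreover have "\<exists>c'. rainbow_set V c' (m + 3)"
      \<comment> \<open>With one centre \<open>Z\<close> and \<open>W\<close> may coincide.\<close>
      by (intro rainbow_set_remainder[OF c, where X = m and Y = "m + 1" and Z = "m + 2" and W = "m + 2"])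
        (auto simp: z)
    ultimately show ?thesis using finish[of "m + 3"] cardV m 4 by simp
  next
    case 5
    then obtain z z' where z: "z \<in> centres" "z' \<in> centres" "z \<noteq> z'"
      using card_le_Suc0_iff_eq[OF finLC(2)] by fastforce
    have "card (?N z \<union> ?N z') = card (?N z) + card (?N z')"
      using disj[OF z] N[OF z(1)] N[OF z(2)] finLC by (intro card_Un_disjoint) (auto intro: finite_subset)
    moreover have "card (?N z \<union> ?N z') \<le> card leaves"
      using N(1)[OF z(1)] N(1)[OF z(2)] finLC by (intro card_mono) auto
    ultimately have "card leaves \<ge> 6" using N(2)[OF z(1)] N(2)[OF z(2)] by linarith
    moreover have "\<exists>c'. rainbow_set V c' (m + 4)"
      by (intro rainbow_set_remainder[OF c, where X = m and Y = "m + 1" and Z = "m + 2" and W = "m + 3"]) auto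
    ultimately show ?thesis using finish[of "m + 4"] cardV m 5 by simp
  qed
qed

end

section \<open>The extremal set and the passage back to \<open>G\<close>\<close>

context three_connected
begin

lemma ex_rainbow_coloring: "\<exists>c M. rainbow_set V c M \<and> 5 * M \<le> 3 * (card V + 1)"
proof -
  \<comment> \<open>The \<open>+ 1\<close> is exactly what a single edge with one color allows:
    \<open>5 + 1 = 3 * 2\<close>.\<close>
  define good where "good H \<longleftrightarrow> H \<subseteq> V \<and> card H \<ge> 2 \<and>
    (\<exists>c m. rainbow_set H c m \<and> m > 0 \<and> 5 * m + 1 \<le> 3 * card H)" for H
  obtain a where a: "a \<in> V" using card_V by fastforce
  then have "card {y. adj a y} \<ge> 3" by (rule card_neighbours)
  then obtain b where b: "adj a b" by fastforce
  have ab: "a \<noteq> b" "b \<in> V" "adj b a" using b adj_irrefl adj_V2 adj_sym by auto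
  have "rainbow_set {a, b} (\<lambda>_. 0) 1"
    using b ab rainbow_walk_single[of "adj_in {a, b}" a b "\<lambda>_. 0"]
      rainbow_walk_single[of "adj_in {a, b}" b a "\<lambda>_. 0"]
    by (auto simp: rainbow_set_def joined_refl intro: joinedI)
  then have "good {a, b}" using a ab by (auto simp: good_def)
  moreover have "card H < Suc (card V)" if "good H" for H
    using that fin card_mono[of V H] by (simp add: good_def)
  ultimately obtain H where H: "good H" and max: "\<And>H'. good H' \<Longrightarrow> card H' \<le> card H"
    using ex_has_greatest_nat[of good "{a, b}" card "Suc (card V)"] by blast
  obtain c m where c: "H \<subseteq> V" "card H \<ge> 2" "rainbow_set H c m" "m > 0" "5 * m + 1 \<le> 3 * card H"
    using H by (auto simp: good_def)
  interpret ear_restricted V adj H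
  proof
    fix a xs b assume e: "ear H a xs b"
    obtain c' where c': "rainbow_set (H \<union> set xs) c' (m + (length xs + 1) div 2)"
      using rainbow_set_ear[OF c(3,4) e] by blast
    have xs: "xs \<noteq> []" "set xs \<inter> H = {}" "distinct xs" "successively adj (a # xs @ [b])"
      using e by (auto simp: ear_def)
    have "finite H" using c fin finite_subset by blast
    then have card: "card (H \<union> set xs) = card H + length xs"
      using xs by (subst card_Un_disjoint) (auto simp: distinct_card)
    have "set xs \<subseteq> V"
    proof
      fix v assume "v \<in> set xs"
      then obtain ys zs where "xs = ys @ v # zs" by (meson split_list)
      then have "successively adj (v # (zs @ [b]))"
        using xs(4) by (auto simp: successively_append_iff successively_Cons)
      then show "v \<in> V" using adj_V by (cases zs) (auto simp: successively_Cons)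
    qed
    show "length xs = 1 \<or> length xs = 3"
    proof (rule ccontr)
      assume "\<not> (length xs = 1 \<or> length xs = 3)"
      then have "5 * (m + (length xs + 1) div 2) + 1 \<le> 3 * (card H + length xs)"
        using c(5) ear_color_count[of "length xs"] by simp
      then have "good (H \<union> set xs)"
        unfolding good_def card using c(1,2,4) c' \<open>set xs \<subseteq> V\<close>
        by (intro conjI exI[of _ c'] exI[of _ "m + (length xs + 1) div 2"]) simp_all
      then show False using max card xs by fastforce
    qed
  qed (use c in auto)
  show ?thesis using ex_remainder_coloring[OF c(3-5)] .
qed

end

text \<open>If the path from \<open>w\<close> already visits \<open>u\<close>, only its part from
  \<open>u\<close> on is kept. This can lose colors, so \<open>F\<close> becomes an upper
  bound.\<close>

lemma (in wf_digraph) rainbow_walk_imp_path: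
  assumes "rainbow_walk A c u F v" "\<And>x y. A x y \<Longrightarrow> x \<rightarrow>\<^bsub>G\<^esub> y" "v \<in> verts G"
  shows "\<exists>p. apath u p v \<and> distinct (map (\<lambda>e. c (edge_of G e)) p) \<and> (\<lambda>e. c (edge_of G e)) ` set p \<subseteq> F"
  using assms
proof (induction rule: rainbow_walk.induct)
  case (Nil u)
  then show ?case by (auto simp: apath_Nil_iff)
next
  case (Cons u w F v)
  let ?c = "\<lambda>e. c (edge_of G e)"
  obtain p where p: "apath w p v" "distinct (map ?c p)" "?c ` set p \<subseteq> F"
    using Cons by blast
  obtain e where e: "e \<in> arcs G" "tail G e = u" "head G e = w"
    using Cons.prems(1)[OF Cons.hyps(1)] by (auto simp: arcs_ends_conv)
  have ce: "?c e = c {u, w}" using e by (simp add: edge_of_def)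
  show ?case
  proof (cases "u \<in> set (awalk_verts w p)")
    case False
    then have "apath u (e # p) v" using p e by (auto simp: apath_Cons_iff)
    then show ?thesis using p ce Cons.hyps(2) by (intro exI[of _ "e # p"]) auto
  next
    case True
    then obtain q r where qr: "p = q @ r" "awalk w q u" "awalk u r v"
      using p awalk_decomp[of w p v u] by (auto simp: apath_def)
    then have "apath u r v" using p by (auto simp: apath_append_iff)
    then show ?thesis using p qr by (intro exI[of _ r]) auto
  qed
qed

theorem theorem1:
  fixes G :: "('a, 'b) pre_digraph" and n :: nat
  assumes "graph G"
    and "k_connected 3 G"
    and "card (verts G) = n"
  shows "real (rc G) \<le> 3 * (real n + 1) / 5"
proof -
  interpret graph G by fact
  interpret three_connected "verts G" "\<lambda>u v. u \<rightarrow>\<^bsub>G\<^esub> v"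
  proof
    show "card (verts G) > 3" using assms(2) by (simp add: k_connected_def)
    show "v \<rightarrow>\<^bsub>G\<^esub> u" if "u \<rightarrow>\<^bsub>G\<^esub> v" for u v using that by (rule graph_symmetric)
    show "\<not> u \<rightarrow>\<^bsub>G\<^esub> u" for u using adj_not_same by blast
    show "u \<in> verts G" if "u \<rightarrow>\<^bsub>G\<^esub> v" for u v using that by (rule adj_in_verts)
    fix S u v assume S: "S \<subseteq> verts G" "card S < 3" "u \<in> verts G - S" "v \<in> verts G - S"
    let ?G = "G \<restriction> (verts G - S)"
    interpret I: wf_digraph ?G by (rule wellformed_induce_subgraph)
    have dom: "x \<rightarrow>\<^bsub>G\<^esub> y \<and> x \<notin> S \<and> y \<notin> S" if "x \<rightarrow>\<^bsub>?G\<^esub> y" for x y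
      using that by (auto simp: arcs_ends_conv)
    \<comment> \<open>Connectedness of a digraph ignores directions; symmetry of the induced
      subgraph turns it into reachability.\<close>
    have "x \<rightarrow>\<^bsub>?G\<^esub> y \<longleftrightarrow> x \<rightarrow>\<^bsub>G\<^esub> y \<and> x \<in> verts G - S \<and> y \<in> verts G - S" for x y
      by (auto simp: arcs_ends_conv)
    then have "symmetric ?G"
      using graph_symmetric by (auto simp: symmetric_def sym_def)
    moreover have "Digraph_Component.connected ?G"
      using assms(2) S by (simp add: k_connected_def)
    ultimately have "u \<rightarrow>\<^sup>*\<^bsub>?G\<^esub> v"
      using I.symmetric_connected_imp_strongly_connected S by (auto simp: strongly_connected_def)
    then show "(\<lambda>x y. x \<rightarrow>\<^bsub>G\<^esub> y \<and> x \<notin> S \<and> y \<notin> S)\<^sup>*\<^sup>* u v"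
      by (induction rule: I.reachable_induct) (use dom in \<open>auto intro: rtranclp.rtrancl_into_rtrancl\<close>)
  qed simp
  obtain c M where c: "rainbow_set (verts G) c M" "5 * M \<le> 3 * (card (verts G) + 1)"
    using ex_rainbow_coloring by blast
  have "\<exists>p. rainbow_path G c u p v" if uv: "u \<in> verts G" "v \<in> verts G" for u v
  proof -
    obtain F where "rainbow_walk (adj_in (verts G)) c u F v" using c uv unfolding rainbow_set_def joined_def by blast
    then show ?thesis using rainbow_walk_imp_path[of _ c u F v] uv unfolding rainbow_path_def by blast
  qed
  then have "rainbow_connected G c" by (simp add: rainbow_connected_def)
  moreover have "c ` edges G \<subseteq> {..<M}" using c by (auto simp: rainbow_set_def)
  ultimately have "rc G \<le> M" unfolding rc_def by (intro Least_le) blast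
  then have "5 * rc G \<le> 5 * M" by simp
  also have "\<dots> \<le> 3 * (n + 1)" using c(2) assms(3) by simp
  finally have "real (5 * rc G) \<le> real (3 * (n + 1))" by (simp only: of_nat_le_iff)
  then show ?thesis by simp
qed

end
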